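(* Let $q$ be a square prime power and let $a,m,d\in\mathrm{GF}(q^2)$ with $a\neq 0$. Denote by $\mathcal{C}(a,m,d)$ the curve of affine equation $y=ax^{\sqrt{q}}+mx+d$. Then the curves $\mathcal{C}(a,m,d)$ meet the Hermitian curve $y^q+y=x^{q+1}$ of $\mathrm{PG}(2,q^2)$ in the following numbers of points (that is, each such curve meets it in one of these numbers of points): $$q-2\sqrt{q}+1,\quad q-\sqrt{q}+1,\quad q+1,\quad q+\sqrt{q}+1.$$
   Context: $\mathrm{GF}(q^2)$ is the finite field with $q^2$ elements, where $q$ is a prime power that is a perfect square, and $\mathrm{PG}(2,q^2)$ is the Desarguesian projective plane over $\mathrm{GF}(q^2)$. Curves are given by their equations in affine coordinates $(x,y)$. *)

theory Defs
  imports "HOL-Number_Theory.Number_Theory"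
begin

(*
  Both curves are sets of affine points, rational over the finite field 'k.
  Their projective closures also share the point (0:1:0), which is the only point of either curve
  on the line at infinity; it is not counted in the intersection numbers
  q - 2 sqrt q + 1, q - sqrt q + 1, q + 1, q + sqrt q + 1.
*)

definition hermitian_curve :: "nat \<Rightarrow> ('k::field \<times> 'k) set" where
  "hermitian_curve q = {(x, y). y ^ q + y = x ^ (q + 1)}"

(* The curve C(a,m,d); the exponent s is the square root of q. *)
definition curve_C :: "nat \<Rightarrow> 'k::field \<Rightarrow> 'k \<Rightarrow> 'k \<Rightarrow> ('k \<times> 'k) set" where
  "curve_C s a m d = {(x, y). y = a * x ^ s + m * x + d}"

end

theory Submission
  imports Defs "HOL-Computational_Algebra.Polynomial"
begin

text \<open>
  Write \<open>\<sigma> x = x ^ s\<close>, an automorphism of order four of \<open>GF(q\<^sup>2) = GF(s\<^sup>4)\<close>, and let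
  \<open>N x = x * \<sigma> (\<sigma> x)\<close> and \<open>T x = x + \<sigma> (\<sigma> x)\<close> be the norm and the trace to \<open>GF(q)\<close>. Substituting the
  equation of \<open>C(a,m,d)\<close> into that of the Hermitian curve gives \<open>N x = T (a * \<sigma> x + m * x + d)\<close>,
  and the translation \<open>x \<mapsto> x + m ^ q\<close> absorbs the linear term: it remains to count the zeros of
  \<open>f x = N x - T (a * \<sigma> x) - e\<close>, where \<open>e \<in> GF(q)\<close>.

  The map \<open>f\<close> mixes two powers of \<open>\<sigma>\<close>, but each \<open>GF(s)\<close>-linear form on the two-dimensional space
  \<open>GF(q)\<close> simplifies it. Up to scalars there are \<open>s + 1\<close> such forms. They can be written as
  \<open>\<phi>\<^sub>v y = y + v * \<sigma> y\<close> for the \<open>s + 1\<close> solutions \<open>v\<close> of \<open>v * \<sigma> v = 1\<close>, since the form sending \<open>y\<close> to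
  \<open>t * y + \<sigma> (t * y)\<close> is proportional to \<open>\<phi>\<^sub>v\<close> for \<open>v = \<sigma> t / t\<close>. Because \<open>v * \<sigma> v = 1\<close>, the form
  \<open>\<phi>\<^sub>v\<close> lets one complete the square (\<open>twisted_trace_defect\<close>):
  \<open>\<phi>\<^sub>v (f x) = \<phi>\<^sub>v (N (x - v * \<sigma> a)) - b\<^sub>v\<close> with \<open>b\<^sub>v = \<phi>\<^sub>v (N (v * \<sigma> a) + e)\<close>. Since the fibres of
  \<open>N\<close> and of \<open>\<phi>\<^sub>v\<close> are known, the number of \<open>x\<close> with \<open>\<phi>\<^sub>v (f x) = 0\<close> is known as well and depends only
  on whether \<open>b\<^sub>v = 0\<close> (\<open>card_twisted_trace_defect\<close>).

  Count the pairs \<open>(x, v)\<close> with \<open>\<phi>\<^sub>v (f x) = 0\<close> in two ways. A zero of \<open>f\<close> is paired with every \<open>v\<close>,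
  and any other \<open>x\<close> with exactly one. This yields \<open>q + s + 1 - k * s\<close> zeros of \<open>f\<close>, where \<open>k\<close> is the
  number of \<open>v\<close> with \<open>b\<^sub>v = 0\<close> (\<open>card_defect_zeros\<close>). Finally \<open>v * b\<^sub>v\<close> is a cubic polynomial in \<open>v\<close>
  with leading coefficient \<open>N (\<sigma> a) \<noteq> 0\<close>, so that \<open>k \<in> {0, 1, 2, 3}\<close> (\<open>card_level_zeros_le\<close>).
\<close>

section \<open>Counting with fibres and with roots\<close>

lemma card_eq_sum_card_fibres:
  assumes "finite A" "finite B" "f ` A \<subseteq> B"
  shows "card A = (\<Sum>b\<in>B. card {x \<in> A. f x = b})"
proof -
  have "(\<Sum>b\<in>B. \<Sum>x\<in>{x \<in> A. f x = b}. 1) = (\<Sum>x\<in>A. 1::nat)"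
    using assms by (intro sum.group) auto
  thus ?thesis by simp
qed

text \<open>
  If a set of \<open>m * n\<close> elements is mapped into at most \<open>n\<close> values with fibres of size at most \<open>m\<close>, then
  there is no slack anywhere. Bounds on the number of roots of a polynomial thereby turn into exact
  counts of the fibres of the norm and of the points of the unit circle.
\<close>
lemma fibres_of_extremal_map:
  fixes m n :: nat
  assumes "finite A" "finite B" "f ` A \<subseteq> B"
    and "card A = m * n" "card B \<le> n" "m > 0"
    and fibre_le: "\<And>b. b \<in> B \<Longrightarrow> card {x \<in> A. f x = b} \<le> m"
  shows "card B = n" and "b \<in> B \<Longrightarrow> card {x \<in> A. f x = b} = m"
proof -
  have total: "m * n = (\<Sum>b\<in>B. card {x \<in> A. f x = b})"
    using card_eq_sum_card_fibres[of A B f] assms by simp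
  also have "\<dots> \<le> (\<Sum>b\<in>B. m)"
    by (intro sum_mono fibre_le)
  finally have "m * n \<le> m * card B" by (simp add: mult.commute)
  with assms show "card B = n" by simp
  show "card {x \<in> A. f x = b} = m" if "b \<in> B"
  proof (rule ccontr)
    assume "card {x \<in> A. f x = b} \<noteq> m"
    with fibre_le[OF that] have "card {x \<in> A. f x = b} < m" by simp
    hence "(\<Sum>b\<in>B. card {x \<in> A. f x = b}) < (\<Sum>b\<in>B. m)"
      using that assms by (intro sum_strict_mono_ex1) auto
    with total \<open>card B = n\<close> show False by (simp add: mult.commute)
  qed
qed

lemma card_nth_roots_le:
  fixes c :: "'a :: idom"
  assumes "n > 0"
  shows "card {x. x ^ n = c} \<le> n"
proof -
  let ?p = "monom 1 n + [:- c:]"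
  have deg: "degree ?p = n"
    using assms by (subst degree_add_eq_left) (auto simp: degree_monom_eq)
  hence "?p \<noteq> 0" using assms by auto
  from card_poly_roots_bound[OF this] have "card {x. poly ?p x = 0} \<le> n"
    using deg by simp
  thus ?thesis by (simp add: poly_monom)
qed

lemma card_cubic_roots_le:
  fixes a b c d :: "'a :: idom"
  assumes "a \<noteq> 0"
  shows "card {x. a * x ^ 3 + b * x ^ 2 + c * x + d = 0} \<le> 3"
proof -
  have "card {x. poly [:d, c, b, a:] x = 0} \<le> 3"
    using card_poly_roots_bound[of "[:d, c, b, a:]"] assms by simp
  thus ?thesis by (simp add: algebra_simps power2_eq_square power3_eq_cube)
qed

lemma finite_field_power_card:
  fixes x :: "'a :: {field, finite}"
  shows "x ^ card (UNIV :: 'a set) = x"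
proof (cases "x = 0")
  case False
  have "(\<Prod>y\<in>UNIV - {0}. x * y) = (\<Prod>y\<in>UNIV - {0}. y)"
    by (rule prod.reindex_bij_witness[of _ "\<lambda>y. y / x" "\<lambda>y. x * y"]) (use False in auto)
  moreover have "(\<Prod>y\<in>UNIV - {0 :: 'a}. y) \<noteq> 0" by simp
  ultimately have "x ^ (card (UNIV :: 'a set) - 1) = 1"
    by (simp add: prod.distrib card_Diff_singleton)
  moreover have "card (UNIV :: 'a set) > 0" by (simp add: card_gt_0_iff)
  ultimately show ?thesis
    by (metis Suc_diff_1 mult.right_neutral power_Suc)
qed (simp add: card_gt_0_iff)

section \<open>Norm, trace and twisted traces in a field with a quartic Frobenius\<close>

text \<open>
  The elements \<open>a\<close> and \<open>e\<close> are the coefficients of the equation \<open>N x = T (a * x ^ s) + e\<close> that is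
  left once the linear term has been translated away. The additivity of \<open>x ^ s\<close> reflects that \<open>s\<close> is a
  power of the characteristic.
\<close>
locale quartic_frobenius =
  fixes s :: nat and a e :: "'k :: {field, finite}"
  assumes s_ge_2: "s \<ge> 2"
    and card_field: "card (UNIV :: 'k set) = s ^ 4"
    and power_s_add: "(x + y :: 'k) ^ s = x ^ s + y ^ s"
    and a_nonzero: "a \<noteq> 0"
    and e_fixed: "e ^ (s ^ 2) = e"
begin

definition frob :: "'k \<Rightarrow> 'k" ("\<sigma>") where
  "\<sigma> x = x ^ s"

definition relnorm :: "'k \<Rightarrow> 'k" where
  "relnorm x = x * \<sigma> (\<sigma> x)"

definition reltrace :: "'k \<Rightarrow> 'k" where
  "reltrace x = x + \<sigma> (\<sigma> x)"

definition subfield :: "'k set" where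
  "subfield = {y. \<sigma> (\<sigma> y) = y}"

text \<open>
  The elements of norm 1 of \<open>GF(s\<^sup>2)\<close> over \<open>GF(s)\<close>: the equation forces \<open>\<sigma> (\<sigma> v) = v\<close>.
\<close>
definition unit_circle :: "'k set" where
  "unit_circle = {v. v * \<sigma> v = 1}"

text \<open>
  For \<open>v\<close> on the unit circle this is, up to a constant factor, a \<open>GF(s)\<close>-linear form on
  \<open>GF(s\<^sup>2)\<close>, and every nonzero form arises, up to a factor, from one \<open>v\<close>; the ordinary trace is the case
  \<open>v = 1\<close>.
\<close>
definition twisted_trace :: "'k \<Rightarrow> 'k \<Rightarrow> 'k" where
  "twisted_trace v y = y + v * \<sigma> y"

definition defect :: "'k \<Rightarrow> 'k" where
  "defect x = relnorm x - reltrace (a * \<sigma> x) - e"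

text \<open>
  The constant \<open>b\<^sub>v\<close> that remains when the square is completed in the twisted trace of the defect.
\<close>
definition level :: "'k \<Rightarrow> 'k" where
  "level v = twisted_trace v (relnorm (v * \<sigma> a) + e)"

lemma frob_add [simp]: "\<sigma> (x + y) = \<sigma> x + \<sigma> y"
  by (simp add: frob_def power_s_add)

lemma frob_mult [simp]: "\<sigma> (x * y) = \<sigma> x * \<sigma> y"
  by (simp add: frob_def power_mult_distrib)

lemma frob_0 [simp]: "\<sigma> 0 = 0" and frob_1 [simp]: "\<sigma> 1 = 1"
  using s_ge_2 by (auto simp: frob_def)

lemma frob_minus [simp]: "\<sigma> (- x) = - \<sigma> x"
  using frob_add[of "- x" x] by (simp add: eq_neg_iff_add_eq_0)

lemma frob_diff [simp]: "\<sigma> (x - y) = \<sigma> x - \<sigma> y"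
  using frob_add[of x "- y"] by simp

lemma frob_eq_0_iff [simp]: "\<sigma> x = 0 \<longleftrightarrow> x = 0"
  using s_ge_2 by (simp add: frob_def)

lemma frob_divide [simp]: "\<sigma> (x / y) = \<sigma> x / \<sigma> y"
  by (simp add: frob_def power_divide)

lemma frob_frob: "\<sigma> (\<sigma> x) = x ^ (s ^ 2)"
  by (simp add: frob_def power2_eq_square flip: power_mult)

lemma frob_4 [simp]: "\<sigma> (\<sigma> (\<sigma> (\<sigma> x))) = x"
  using finite_field_power_card[of x]
  by (simp add: card_field frob_def eval_nat_numeral mult.assoc flip: power_mult)

lemma e_in_subfield [simp]: "\<sigma> (\<sigma> e) = e"
  using e_fixed by (simp add: frob_frob)

lemma relnorm_in_subfield: "relnorm x \<in> subfield"
  by (simp add: relnorm_def subfield_def mult.commute)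

lemma relnorm_eq_0_iff: "relnorm x = 0 \<longleftrightarrow> x = 0"
  by (simp add: relnorm_def)

lemma defect_in_subfield: "defect x \<in> subfield"
  by (simp add: defect_def relnorm_def reltrace_def subfield_def algebra_simps)

lemma frob_unit_circle:
  assumes "v \<in> unit_circle"
  shows "v * \<sigma> v = 1" "\<sigma> (\<sigma> v) = v"
proof -
  show "v * \<sigma> v = 1" using assms by (simp add: unit_circle_def)
  hence "\<sigma> v * \<sigma> (\<sigma> v) = \<sigma> v * v" "\<sigma> v \<noteq> 0"
    by (auto simp: mult.commute simp flip: frob_mult)
  thus "\<sigma> (\<sigma> v) = v" by simp
qed

text \<open>
  The norm maps the \<open>s\<^sup>4 - 1 = (s\<^sup>2 + 1) * (s\<^sup>2 - 1)\<close> nonzero elements into the nonzero elements of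
  the subfield. The latter are roots of \<open>y ^ (s\<^sup>2 - 1) = 1\<close>, and a fibre consists of roots of
  \<open>x ^ (s\<^sup>2 + 1) = y\<close>, so that both root bounds are attained.
\<close>
lemma
  shows card_subfield: "card subfield = s ^ 2"
    and card_relnorm_fibre: "y \<in> subfield - {0} \<Longrightarrow> card {x. relnorm x = y} = s ^ 2 + 1"
proof -
  have s2: "s ^ 2 \<ge> 2 ^ 2" using s_ge_2 by (intro power_mono) auto
  have "subfield - {0} \<subseteq> {y. y ^ (s ^ 2 - 1) = 1}"
  proof
    fix y assume "y \<in> subfield - {0}"
    hence "y ^ (s ^ 2) = y" "y \<noteq> 0" by (auto simp: subfield_def frob_frob)
    moreover have "y ^ (s ^ 2) = y * y ^ (s ^ 2 - 1)"
      using power_minus_mult[of "s ^ 2" y] s_ge_2 by (simp add: mult.commute)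
    ultimately show "y \<in> {y. y ^ (s ^ 2 - 1) = 1}" by simp
  qed
  hence "card (subfield - {0}) \<le> card {y :: 'k. y ^ (s ^ 2 - 1) = 1}"
    by (intro card_mono) auto
  also have "\<dots> \<le> s ^ 2 - 1"
    by (rule card_nth_roots_le) (use s2 in simp)
  finally have le: "card (subfield - {0}) \<le> s ^ 2 - 1" .
  have fibre: "card {x \<in> UNIV - {0}. relnorm x = y} \<le> s ^ 2 + 1" for y
  proof -
    have "card {x \<in> UNIV - {0}. relnorm x = y} \<le> card {x :: 'k. x ^ (s ^ 2 + 1) = y}"
      by (intro card_mono) (auto simp: relnorm_def frob_frob)
    also have "\<dots> \<le> s ^ 2 + 1" by (rule card_nth_roots_le) simp
    finally show ?thesis .
  qed
  have "s ^ 4 - 1 = (s ^ 2 + 1) * (s ^ 2 - 1)"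
    by (simp add: algebra_simps diff_mult_distrib2 flip: power_add)
  hence card_units: "card (UNIV - {0 :: 'k}) = (s ^ 2 + 1) * (s ^ 2 - 1)"
    by (simp add: card_Diff_singleton card_field)
  have image: "relnorm ` (UNIV - {0}) \<subseteq> subfield - {0}"
    using relnorm_in_subfield by (auto simp: relnorm_eq_0_iff)
  note extremal = fibres_of_extremal_map[OF _ _ image card_units le _ fibre]
  have "card (subfield - {0}) = s ^ 2 - 1" by (rule extremal(1)) auto
  moreover have "0 \<in> subfield" by (simp add: subfield_def)
  ultimately show "card subfield = s ^ 2"
    using s2 by (simp add: card_Diff_singleton)
  show "card {x. relnorm x = y} = s ^ 2 + 1" if "y \<in> subfield - {0}"
  proof -
    have "{x. relnorm x = y} = {x \<in> UNIV - {0}. relnorm x = y}"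
      using that relnorm_eq_0_iff by auto
    thus ?thesis using extremal(2)[OF _ _ _ that] by simp
  qed
qed

lemma card_relnorm_preimage:
  assumes "Y \<subseteq> subfield - {0}"
  shows "card {x. relnorm x \<in> Y} = card Y * (s ^ 2 + 1)"
proof -
  have "card {x. relnorm x \<in> Y} = (\<Sum>y\<in>Y. card {x \<in> {x. relnorm x \<in> Y}. relnorm x = y})"
    by (intro card_eq_sum_card_fibres) auto
  also have "\<dots> = (\<Sum>y\<in>Y. s ^ 2 + 1)"
  proof (intro sum.cong refl)
    fix y assume y: "y \<in> Y"
    hence "{x \<in> {x. relnorm x \<in> Y}. relnorm x = y} = {x. relnorm x = y}" by auto
    thus "card {x \<in> {x. relnorm x \<in> Y}. relnorm x = y} = s ^ 2 + 1"
      using card_relnorm_fibre y assms by auto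
  qed
  finally show ?thesis by simp
qed

lemma twisted_trace_0 [simp]: "twisted_trace v 0 = 0"
  by (simp add: twisted_trace_def)

lemma twisted_trace_eq_0_iff:
  assumes "y \<noteq> 0"
  shows "twisted_trace v y = 0 \<longleftrightarrow> - y / \<sigma> y = v"
proof -
  have "twisted_trace v y = 0 \<longleftrightarrow> - y = v * \<sigma> y"
    by (auto simp: twisted_trace_def add_eq_0_iff)
  also have "\<dots> \<longleftrightarrow> - y / \<sigma> y = v"
    using assms by (subst nonzero_divide_eq_eq) auto
  finally show ?thesis .
qed

text \<open>
  The parameter of the form that kills \<open>y\<close> lies on the unit circle: as \<open>\<sigma> (\<sigma> y) = y\<close>, it is mapped
  to its inverse by \<open>\<sigma>\<close>.
\<close>
lemma unit_circle_representative:
  assumes "y \<in> subfield - {0}"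
  shows "- y / \<sigma> y \<in> unit_circle"
  using assms by (auto simp: unit_circle_def subfield_def)

text \<open>
  The map \<open>y \<mapsto> - y / \<sigma> y\<close> sends the \<open>s\<^sup>2 - 1 = (s - 1) * (s + 1)\<close> nonzero elements of the subfield
  to the unit circle, which has at most \<open>s + 1\<close> points. Its fibre over \<open>v\<close> consists of the nonzero
  elements of the kernel of the form with parameter \<open>v\<close>, at most \<open>s - 1\<close> of them as they satisfy
  \<open>y ^ (s - 1) = - 1 / v\<close>.
\<close>
lemma
  shows card_unit_circle: "card unit_circle = s + 1"
    and card_twisted_trace_kernel:
      "v \<in> unit_circle \<Longrightarrow> card {y \<in> subfield. twisted_trace v y = 0} = s"
proof -
  have "card unit_circle \<le> card {v :: 'k. v ^ (s + 1) = 1}"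
    by (intro card_mono) (auto simp: unit_circle_def frob_def)
  also have "\<dots> \<le> s + 1" by (rule card_nth_roots_le) simp
  finally have le: "card unit_circle \<le> s + 1" .
  have fibre: "card {y \<in> subfield - {0}. - y / \<sigma> y = v} \<le> s - 1" for v
  proof -
    have "{y \<in> subfield - {0}. - y / \<sigma> y = v} \<subseteq> {y. y ^ (s - 1) = - 1 / v}"
    proof
      fix y assume y: "y \<in> {y \<in> subfield - {0}. - y / \<sigma> y = v}"
      have "\<sigma> y = y * y ^ (s - 1)"
        using s_ge_2 power_Suc[of y "s - 1"] by (simp add: frob_def)
      with y show "y \<in> {y. y ^ (s - 1) = - 1 / v}"
        by (auto simp: field_simps)
    qed
    hence "card {y \<in> subfield - {0}. - y / \<sigma> y = v} \<le> card {y :: 'k. y ^ (s - 1) = - 1 / v}"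
      by (intro card_mono) auto
    also have "\<dots> \<le> s - 1" by (rule card_nth_roots_le) (use s_ge_2 in simp)
    finally show ?thesis .
  qed
  have zero: "0 \<in> subfield" by (simp add: subfield_def)
  have "s ^ 2 - 1 = (s - 1) * (s + 1)"
    by (simp add: algebra_simps diff_mult_distrib2 power2_eq_square)
  hence card_units: "card (subfield - {0}) = (s - 1) * (s + 1)"
    using zero by (simp add: card_Diff_singleton card_subfield)
  have image: "(\<lambda>y. - y / \<sigma> y) ` (subfield - {0}) \<subseteq> unit_circle"
    using unit_circle_representative by blast
  note extremal = fibres_of_extremal_map[OF _ _ image card_units le _ fibre]
  show "card unit_circle = s + 1" by (rule extremal(1)) (use s_ge_2 in auto)
  show "card {y \<in> subfield. twisted_trace v y = 0} = s" if v: "v \<in> unit_circle"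
  proof -
    have "{y \<in> subfield. twisted_trace v y = 0}
        = insert 0 {y \<in> subfield - {0}. - y / \<sigma> y = v}"
      using zero twisted_trace_eq_0_iff by auto
    moreover have "card {y \<in> subfield - {0}. - y / \<sigma> y = v} = s - 1"
      by (rule extremal(2)) (use s_ge_2 v in auto)
    ultimately show ?thesis using s_ge_2 by simp
  qed
qed

lemma card_twisted_trace_fibre:
  assumes "v \<in> unit_circle" "z \<in> subfield"
  shows "card {y \<in> subfield. twisted_trace v y = twisted_trace v z} = s"
proof -
  have "bij_betw (\<lambda>y. y + z) {y \<in> subfield. twisted_trace v y = 0}
      {y \<in> subfield. twisted_trace v y = twisted_trace v z}"
    by (rule bij_betw_byWitness[where f' = "\<lambda>y. y - z"])
      (use assms(2) in \<open>auto simp: subfield_def twisted_trace_def algebra_simps\<close>)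
  from bij_betw_same_card[OF this] show ?thesis
    using card_twisted_trace_kernel[OF assms(1)] by simp
qed

text \<open>
  This detects zero: a nonzero vector of a plane over \<open>GF(s)\<close> is killed by one linear form up to
  scalars, the zero vector by all of them.
\<close>
lemma card_twisted_traces_vanishing:
  assumes "y \<in> subfield"
  shows "card {v \<in> unit_circle. twisted_trace v y = 0} = (if y = 0 then s + 1 else 1)"
proof (cases "y = 0")
  case True
  thus ?thesis by (simp add: card_unit_circle)
next
  case False
  hence "{v \<in> unit_circle. twisted_trace v y = 0} = {- y / \<sigma> y}"
    using unit_circle_representative[of y] assms twisted_trace_eq_0_iff by auto
  thus ?thesis using False by simp
qed

section \<open>Completing the square and the cubic\<close>

text \<open>
  Completing the square: the cross terms of \<open>N (x - c)\<close> are \<open>- T (\<sigma> (\<sigma> c) * x)\<close>, and the twisted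
  trace of this has to agree with that of \<open>- T (a * \<sigma> x)\<close>. For \<open>c = v * \<sigma> a\<close> the coefficients of
  \<open>x\<close> and \<open>\<sigma> (\<sigma> x)\<close> agree because \<open>\<sigma> (\<sigma> v) = v\<close>, and those of \<open>\<sigma> x\<close> and \<open>\<sigma> (\<sigma> (\<sigma> x))\<close> because
  \<open>v * \<sigma> v = 1\<close>.
\<close>
lemma twisted_trace_defect:
  assumes "v \<in> unit_circle"
  shows "twisted_trace v (defect x) = twisted_trace v (relnorm (x - v * \<sigma> a)) - level v"
proof -
  have "twisted_trace v (defect x) = twisted_trace v (relnorm (x - v * \<sigma> a)) - level v
      + (v * \<sigma> v - 1) * reltrace (a * \<sigma> x)"
    by (simp add: twisted_trace_def level_def defect_def relnorm_def reltrace_def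
        frob_unit_circle(2)[OF assms] algebra_simps)
  thus ?thesis by (simp add: frob_unit_circle(1)[OF assms])
qed

text \<open>
  After the substitution \<open>z = x - v * \<sigma> a\<close> the condition says that \<open>N z\<close> lies in a fibre \<open>Y\<close> of the
  form, which has \<open>s\<close> elements. Each nonzero element of \<open>Y\<close> has \<open>s\<^sup>2 + 1\<close> preimages under the norm,
  while 0, which belongs to \<open>Y\<close> iff the level vanishes, has only one.
\<close>
lemma card_twisted_trace_defect:
  assumes v: "v \<in> unit_circle"
  shows "card {x. twisted_trace v (defect x) = 0} =
    (if level v = 0 then 1 + (s - 1) * (s ^ 2 + 1) else s * (s ^ 2 + 1))"
proof -
  define Y where "Y = {y \<in> subfield. twisted_trace v y = level v}"
  have "relnorm (v * \<sigma> a) + e \<in> subfield"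
    using relnorm_in_subfield by (simp add: subfield_def)
  hence cardY: "card Y = s"
    unfolding Y_def level_def by (rule card_twisted_trace_fibre[OF v])
  have "bij_betw (\<lambda>x. x - v * \<sigma> a) {x. twisted_trace v (defect x) = 0} {z. relnorm z \<in> Y}"
    by (rule bij_betw_byWitness[where f' = "\<lambda>z. z + v * \<sigma> a"])
      (auto simp: Y_def twisted_trace_defect[OF v] relnorm_in_subfield)
  hence shift: "card {x. twisted_trace v (defect x) = 0} = card {z. relnorm z \<in> Y}"
    by (rule bij_betw_same_card)
  show ?thesis
  proof (cases "level v = 0")
    case True
    hence "0 \<in> Y" by (simp add: Y_def subfield_def)
    hence split: "{z. relnorm z \<in> Y} = insert 0 {z. relnorm z \<in> Y - {0}}"
      by (auto simp: relnorm_eq_0_iff) (simp add: relnorm_def)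
    have "card {z. relnorm z \<in> Y - {0}} = card (Y - {0}) * (s ^ 2 + 1)"
      by (rule card_relnorm_preimage) (auto simp: Y_def)
    thus ?thesis
      using True \<open>0 \<in> Y\<close> cardY shift
      by (simp only: split) (simp add: relnorm_def card_Diff_singleton)
  next
    case False
    hence "card {z. relnorm z \<in> Y} = card Y * (s ^ 2 + 1)"
      by (intro card_relnorm_preimage) (auto simp: Y_def)
    thus ?thesis using False cardY shift by simp
  qed
qed

text \<open>
  On the unit circle \<open>\<sigma> v = 1 / v\<close> and \<open>N (v * \<sigma> a) = A * v\<^sup>2\<close> with \<open>A = N (\<sigma> a)\<close>. Hence the level is
  \<open>A * v\<^sup>2 + e + v * (\<sigma> A / v\<^sup>2 + \<sigma> e)\<close>, and multiplying it by \<open>v\<close> gives a cubic polynomial.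
\<close>
lemma card_level_zeros_le: "card {v \<in> unit_circle. level v = 0} \<le> 3"
proof -
  let ?A = "relnorm (\<sigma> a)"
  have "{v \<in> unit_circle. level v = 0}
      \<subseteq> {v. ?A * v ^ 3 + \<sigma> e * v ^ 2 + e * v + \<sigma> ?A = 0}"
  proof safe
    fix v assume v: "v \<in> unit_circle" "level v = 0"
    have "v * level v = ?A * v ^ 3 + \<sigma> e * v ^ 2 + e * v + (v * \<sigma> v) ^ 2 * \<sigma> ?A"
      by (simp add: level_def twisted_trace_def relnorm_def frob_unit_circle(2)[OF v(1)]
          algebra_simps power2_eq_square power3_eq_cube)
    thus "?A * v ^ 3 + \<sigma> e * v ^ 2 + e * v + \<sigma> ?A = 0"
      using v(2) by (simp add: frob_unit_circle(1)[OF v(1)])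
  qed
  hence "card {v \<in> unit_circle. level v = 0}
      \<le> card {v. ?A * v ^ 3 + \<sigma> e * v ^ 2 + e * v + \<sigma> ?A = 0}"
    by (intro card_mono) auto
  also have "\<dots> \<le> 3"
    by (rule card_cubic_roots_le) (simp add: relnorm_eq_0_iff a_nonzero)
  finally show ?thesis .
qed

text \<open>
  Double counting of the pairs \<open>(x, v)\<close> such that the form with parameter \<open>v\<close> kills the defect of
  \<open>x\<close>; the resulting linear equation is solved for the number of zeros of the defect.
\<close>
lemma card_defect_zeros:
  "int (card {x. defect x = 0}) =
    int s ^ 2 + int s + 1 - int (card {v \<in> unit_circle. level v = 0}) * int s"
proof -
  define n where "n = card {x. defect x = 0}"
  define k where "k = card {v \<in> unit_circle. level v = 0}"
  have n_le: "n \<le> s ^ 4"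
    unfolding n_def card_field[symmetric] by (intro card_mono) auto
  have compl_n: "card {x. defect x \<noteq> 0} = s ^ 4 - n"
    unfolding n_def card_field[symmetric]
    using card_Diff_subset[of "{x. defect x = 0}" UNIV] by (simp add: set_diff_eq)
  have k_le: "k \<le> s + 1"
    unfolding k_def card_unit_circle[symmetric] by (intro card_mono) auto
  have compl_k: "card {v \<in> unit_circle. level v \<noteq> 0} = s + 1 - k"
  proof -
    have "{v \<in> unit_circle. level v \<noteq> 0} = unit_circle - {v \<in> unit_circle. level v = 0}"
      by auto
    thus ?thesis by (simp add: card_Diff_subset k_def card_unit_circle)
  qed
  have "(\<Sum>x\<in>UNIV. card {v \<in> unit_circle. twisted_trace v (defect x) = 0})
      = (\<Sum>v\<in>unit_circle. card {x \<in> UNIV. twisted_trace v (defect x) = 0})"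
    by (rule sum_multicount_gen[symmetric]) auto
  moreover have "(\<Sum>x\<in>UNIV. card {v \<in> unit_circle. twisted_trace v (defect x) = 0})
      = n * (s + 1) + (s ^ 4 - n)"
  proof -
    have "(\<Sum>x\<in>UNIV. if defect x = 0 then s + 1 else 1)
        = (\<Sum>x | defect x = 0. s + 1) + (\<Sum>x | defect x \<noteq> 0. 1)"
      by (simp add: sum.If_cases Collect_neg_eq)
    thus ?thesis
      by (simp add: card_twisted_traces_vanishing defect_in_subfield n_def[symmetric] compl_n)
  qed
  moreover have "(\<Sum>v\<in>unit_circle. card {x \<in> UNIV. twisted_trace v (defect x) = 0})
      = k * (1 + (s - 1) * (s ^ 2 + 1)) + (s + 1 - k) * (s * (s ^ 2 + 1))"
  proof -
    define M N where "M = 1 + (s - 1) * (s ^ 2 + 1)" and "N = s * (s ^ 2 + 1)"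
    have "(\<Sum>v\<in>unit_circle. card {x \<in> UNIV. twisted_trace v (defect x) = 0})
        = (\<Sum>v\<in>unit_circle. if level v = 0 then M else N)"
      by (intro sum.cong refl) (simp add: card_twisted_trace_defect M_def N_def)
    also have "\<dots> = (\<Sum>v | v \<in> unit_circle \<and> level v = 0. M)
        + (\<Sum>v | v \<in> unit_circle \<and> level v \<noteq> 0. N)"
      by (simp add: sum.If_cases Int_def)
    finally show ?thesis by (simp add: k_def[symmetric] compl_k M_def N_def)
  qed
  ultimately have "n * (s + 1) + (s ^ 4 - n)
      = k * (1 + (s - 1) * (s ^ 2 + 1)) + (s + 1 - k) * (s * (s ^ 2 + 1))"
    by simp
  hence "int (n * (s + 1) + (s ^ 4 - n))
      = int (k * (1 + (s - 1) * (s ^ 2 + 1)) + (s + 1 - k) * (s * (s ^ 2 + 1)))"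
    by (rule arg_cong)
  moreover have "int (s ^ 4 - n) = int s ^ 4 - int n" "int (s - 1) = int s - 1"
      "int (s + 1 - k) = int s + 1 - int k"
    using n_le k_le s_ge_2 by (simp_all add: of_nat_diff)
  ultimately have "int n * (int s + 1) + (int s ^ 4 - int n)
      = int k * (1 + (int s - 1) * (int s ^ 2 + 1)) + (int s + 1 - int k) * (int s * (int s ^ 2 + 1))"
    by (simp only: of_nat_add of_nat_mult of_nat_power of_nat_1)
  hence "int s * int n = int s * (int s ^ 2 + int s + 1 - int k * int s)"
    by (simp add: algebra_simps power2_eq_square power4_eq_xxxx)
  thus ?thesis using s_ge_2 by (simp add: n_def k_def)
qed

end

section \<open>Intersection numbers with the Hermitian curve\<close>

lemma primepow_card_CHAR_power:
  assumes "primepow q" "q = s ^ 2" "card (UNIV :: 'k :: {field, finite} set) = q ^ 2"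
  shows "prime CHAR('k)" "\<exists>j. s = CHAR('k) ^ j"
proof -
  have "CHAR('k) > 0" by (rule finite_imp_CHAR_pos) simp
  thus char: "prime CHAR('k)" by (rule prime_CHAR_semidom)
  obtain p k where p: "prime p" "q = p ^ k"
    using assms(1) by (auto simp: primepow_def)
  have "CHAR('k) dvd q ^ 2" using CHAR_dvd_CARD[where 'a = 'k] assms(3) by simp
  hence "CHAR('k) dvd p" using char p(2) by (metis prime_dvd_power)
  hence "CHAR('k) = p" using char p(1) by (simp add: primes_dvd_imp_eq)
  moreover have "s dvd p ^ k" using assms(2) p(2) by (metis dvd_triv_left power2_eq_square)
  ultimately show "\<exists>j. s = CHAR('k) ^ j"
    using p(1) by (auto simp: divides_primepow_nat)
qed

theorem theorem1p3:
  fixes q s :: nat and a m d :: "'k :: {field, finite}"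
  assumes "primepow q"
    and "q = s ^ 2"
    and "card (UNIV :: 'k set) = q ^ 2"
    and "a \<noteq> 0"
  shows "int (card (curve_C s a m d \<inter> hermitian_curve q)) \<in>
    {int q - 2 * int s + 1, int q - int s + 1, int q + 1, int q + int s + 1}"
proof -
  have char: "prime CHAR('k)" by (rule primepow_card_CHAR_power(1)[OF assms(1-3)])
  obtain j where j: "s = CHAR('k) ^ j"
    using primepow_card_CHAR_power(2)[OF assms(1-3)] by blast
  have card: "card (UNIV :: 'k set) = s ^ 4"
    using assms(2,3) by (simp flip: power_mult)
  have power_s_add: "(x + y :: 'k) ^ s = x ^ s + y ^ s" for x y
    by (rule freshmans_dream'[OF char j])
  have s_ge_2: "s \<ge> 2"
    using primepow_gt_Suc_0[OF assms(1)] assms(2)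
    by (cases s; cases "s - 1") auto
  have power_q_add: "(x + y :: 'k) ^ q = x ^ q + y ^ q" for x y
    by (simp add: assms(2) power2_eq_square power_mult power_s_add)
  have power_q_q [simp]: "(x ^ q) ^ q = x" for x :: 'k
    using finite_field_power_card[of x] assms(3) by (simp add: power2_eq_square flip: power_mult)
  \<comment> \<open>With \<open>u = m ^ q\<close> one has \<open>N (x + u) = N x + T (m * x) + N m\<close> and
      \<open>T (m * (x + u)) = T (m * x) + 2 * N m\<close>; in the difference of the two the terms linear in \<open>x\<close>
      cancel and \<open>- N m\<close> is left, which \<open>e\<close> collects together with the trace of \<open>c\<close>.\<close>
  define c where "c = a * (m ^ q) ^ s + d"
  define e where "e = c + c ^ q + m * m ^ q"
  have "e ^ q = e"
    by (simp add: e_def power_q_add power_mult_distrib algebra_simps)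
  then interpret quartic_frobenius s a e
    using s_ge_2 card power_s_add assms by unfold_locales auto
  have defect_shift: "defect x = 0 \<longleftrightarrow>
      (a * (x + m ^ q) ^ s + m * (x + m ^ q) + d) ^ q
        + (a * (x + m ^ q) ^ s + m * (x + m ^ q) + d) = (x + m ^ q) ^ (q + 1)" for x
  proof -
    have "defect x = (x + m ^ q) ^ (q + 1) - (a * (x + m ^ q) ^ s + m * (x + m ^ q) + d) ^ q
        - (a * (x + m ^ q) ^ s + m * (x + m ^ q) + d)"
      unfolding defect_def relnorm_def reltrace_def frob_frob assms(2)[symmetric]
      by (simp add: e_def c_def frob_def power_q_add power_s_add power_mult_distrib algebra_simps)
    thus ?thesis by (simp only: diff_diff_eq right_minus_eq) (rule eq_commute)
  qed
  have "bij_betw (\<lambda>x. (x + m ^ q, a * (x + m ^ q) ^ s + m * (x + m ^ q) + d))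
      {x. defect x = 0} (curve_C s a m d \<inter> hermitian_curve q)"
    by (rule bij_betw_byWitness[where f' = "\<lambda>(x, y). x - m ^ q"])
      (auto simp: curve_C_def hermitian_curve_def defect_shift)
  hence "card (curve_C s a m d \<inter> hermitian_curve q) = card {x. defect x = 0}"
    by (rule bij_betw_same_card[symmetric])
  moreover have "card {v \<in> unit_circle. level v = 0} \<in> {0, 1, 2, 3}"
    using card_level_zeros_le unfolding insert_iff by linarith
  ultimately show ?thesis
    using card_defect_zeros assms(2) by auto
qed

end
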